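(* Let $G$ be a group, $A=\bigoplus_{g\in G}A_g$ an epsilon-strongly $G$-graded ring and $R=A_1$. Assume that $R$ is commutative and let $\gamma=(R\epsilon_g,\gamma_g)_{g\in G}$ be the partial action of $G$ on $R$ defined by $\gamma_g:R\epsilon_{g^{-1}}\to R\epsilon_g$, $\gamma_g(a)=\sum_{i=1}^{n_g}u_{i,g}\,a\,v_{i,g^{-1}}$. If $R^\gamma\subset R$ is a partial Galois extension, then $A$ is an Azumaya $R^\gamma$-algebra containing $R$ as a maximal commutative subalgebra.
   Context: Rings are associative and unital. For subsets $X,Y$ of a ring, $XY$ is the set of finite sums of products $xy$. A $G$-graded unital ring $A=\bigoplus_{g\in G}A_g$ (so $A_gA_h\subseteq A_{gh}$) is epsilon-strongly graded if for every $g\in G$ there is $\epsilon_g\in A_gA_{g^{-1}}$ with $\epsilon_ga=a=a\epsilon_{g^{-1}}$ for all $a\in A_g$. The element $\epsilon_g$ is unique and is a central idempotent of $R=A_1$. For each $g\in G$ fix a positive integer $n_g$ and elements $u_{i,g}\in A_g$, $v_{i,g^{-1}}\in A_{g^{-1}}$ ($1\le i\le n_g$) with $\sum_{i=1}^{n_g}u_{i,g}v_{i,g^{-1}}=\epsilon_g$, where $n_1=1$ and $u_{1,1}=v_{1,1}=1$. When $R$ is commutative, it is known that the maps $\gamma_g$ form a (unital) partial action $\gamma$ of $G$ on $R$. The subring of invariants is $R^\gamma=\{t\in R:\gamma_g(t\epsilon_{g^{-1}})=t\epsilon_g\text{ for all }g\in G\}$. The extension $R^\gamma\subset R$ is a partial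 Galois extension if there are a positive integer $m$ and elements $x_i,y_i\in R$, $1\le i\le m$, such that $\sum_{i=1}^m x_i\gamma_g(y_i\epsilon_{g^{-1}})=\delta_{1,g}$ for all $g\in G$ (i.e. the sum is $1$ if $g=1$ and $0$ otherwise). An algebra $T$ over a commutative ring $S$ is Azumaya if $Z(T)=S$ and $T$ is separable over $S$.
   Formalization: It is additionally assumed that only finitely many A_g are nonzero (automatic for finite G); for infinite G the claim fails without this, and an Azumaya A over R^γ always satisfies it, being finitely generated over R^γ. *)

theory Defs
  imports Complex_Main "HOL-Library.Poly_Mapping"
begin

text \<open>
  The group is a type of class group_add. That class does not include commutativity; the group
  law, neutral element and inverse are written g + h, 0 and - g instead of gh, 1 and the inverse
  of g. The ring A is a type of sort {ring, monoid_mult}: associative and unital, not necessarily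
  commutative, and unlike ring_1 without the axiom that 0 and 1 are different. All other rings
  that occur are subsets of it.
\<close>

section \<open>Epsilon-strongly graded rings\<close>

definition set_mult :: "'a::{ring,monoid_mult} set \<Rightarrow> 'a set \<Rightarrow> 'a set" where
  "set_mult X Y = {(\<Sum>i<k. x i * y i) | (k::nat) x y. \<forall>i<k. x i \<in> X \<and> y i \<in> Y}"

definition additive_subgroup :: "'a::{ring,monoid_mult} set \<Rightarrow> bool" where
  "additive_subgroup X \<longleftrightarrow> 0 \<in> X \<and> (\<forall>a\<in>X. \<forall>b\<in>X. a - b \<in> X)"

definition graded_ring :: "('g::group_add \<Rightarrow> 'a::{ring,monoid_mult} set) \<Rightarrow> bool" where
  "graded_ring A \<longleftrightarrow>
     (\<forall>g. additive_subgroup (A g)) \<and>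
     (\<forall>a. \<exists>!c. (\<forall>g. c g \<in> A g) \<and> finite {g. c g \<noteq> 0} \<and> a = (\<Sum>g | c g \<noteq> 0. c g)) \<and>
     (\<forall>g h. set_mult (A g) (A h) \<subseteq> A (g + h))"

definition epsilon_strongly_graded ::
    "('g::group_add \<Rightarrow> 'a::{ring,monoid_mult} set) \<Rightarrow> ('g \<Rightarrow> 'a) \<Rightarrow> bool" where
  "epsilon_strongly_graded A \<epsilon> \<longleftrightarrow>
     graded_ring A \<and>
     (\<forall>g. \<epsilon> g \<in> set_mult (A g) (A (- g)) \<and> (\<forall>a\<in>A g. \<epsilon> g * a = a \<and> a * \<epsilon> (- g) = a))"

text \<open>
  The second index of v is the degree, so the element written v with indices i and inverse of g
  is v i (- g), where i runs up to n g (not n (- g)).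
\<close>

definition epsilon_decomposition ::
    "('g::group_add \<Rightarrow> 'a::{ring,monoid_mult} set) \<Rightarrow> ('g \<Rightarrow> 'a) \<Rightarrow>
     ('g \<Rightarrow> nat) \<Rightarrow> (nat \<Rightarrow> 'g \<Rightarrow> 'a) \<Rightarrow> (nat \<Rightarrow> 'g \<Rightarrow> 'a) \<Rightarrow> bool" where
  "epsilon_decomposition A \<epsilon> n u v \<longleftrightarrow>
     (\<forall>g. n g > 0 \<and>
          (\<forall>i\<in>{1..n g}. u i g \<in> A g \<and> v i (- g) \<in> A (- g)) \<and>
          (\<Sum>i=1..n g. u i g * v i (- g)) = \<epsilon> g) \<and>
     n 0 = 1 \<and> u 1 0 = 1 \<and> v 1 0 = 1"

section \<open>The partial action, its invariants, partial Galois extensions\<close>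

text \<open>
  For g in G the map of the partial action is the restriction of gam n u v g to the ideal of R
  generated by the idempotent of - g; it is only ever applied to elements of that ideal.
\<close>

definition gam ::
    "('g::group_add \<Rightarrow> nat) \<Rightarrow> (nat \<Rightarrow> 'g \<Rightarrow> 'a::{ring,monoid_mult}) \<Rightarrow> (nat \<Rightarrow> 'g \<Rightarrow> 'a) \<Rightarrow>
     'g \<Rightarrow> 'a \<Rightarrow> 'a" where
  "gam n u v g a = (\<Sum>i=1..n g. u i g * a * v i (- g))"

definition invariants ::
    "'a::{ring,monoid_mult} set \<Rightarrow> ('g::group_add \<Rightarrow> 'a) \<Rightarrow> ('g \<Rightarrow> 'a \<Rightarrow> 'a) \<Rightarrow> 'a set" where
  "invariants R \<epsilon> \<gamma> = {t \<in> R. \<forall>g. \<gamma> g (t * \<epsilon> (- g)) = t * \<epsilon> g}"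

definition partial_galois ::
    "'a::{ring,monoid_mult} set \<Rightarrow> ('g::group_add \<Rightarrow> 'a) \<Rightarrow> ('g \<Rightarrow> 'a \<Rightarrow> 'a) \<Rightarrow> bool" where
  "partial_galois R \<epsilon> \<gamma> \<longleftrightarrow>
     (\<exists>m>0. \<exists>x y. (\<forall>i\<in>{1..m::nat}. x i \<in> R \<and> y i \<in> R) \<and>
        (\<forall>g. (\<Sum>i=1..m. x i * \<gamma> g (y i * \<epsilon> (- g))) = (if g = 0 then 1 else 0)))"

text \<open>
  Pitfall: partial Galois theory is usually set up for finite groups, and the usual consequences
  (trace map, separability) need that only finitely many A g are nonzero. Over an infinite group
  the condition above does not enforce this: let A be the ring of those sequences, indexed by
  n = 1, 2, ..., of 2x2 matrices over a field that are eventually equal to a constant diagonal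
  matrix, graded by the integers with the matrix units E21 and E12 in position n homogeneous of
  degrees n and -n and the diagonal sequences of degree 0. The constant sequences E11 and E22,
  used both as x and as y, satisfy the condition, but A is not separable over its centre.
\<close>

section \<open>Azumaya algebras\<close>

text \<open>
  T is the whole type and S a subring of it. The tensor product of T with itself over S is the
  free abelian group on T x T modulo the subgroup tensor_rels S. Each of its elements is a finite
  sum of pure tensors, hence is given by a list of pairs; tensor_eq S is equality in the tensor
  product.
\<close>

inductive_set tensor_rels ::
    "'a::{ring,monoid_mult} set \<Rightarrow> (('a \<times> 'a) \<Rightarrow>\<^sub>0 int) set" for S where
  zero: "0 \<in> tensor_rels S"
| diff: "p \<in> tensor_rels S \<Longrightarrow> q \<in> tensor_rels S \<Longrightarrow> p - q \<in> tensor_rels S"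
| add_left: "Poly_Mapping.single (a + a', b) 1 - Poly_Mapping.single (a, b) 1
               - Poly_Mapping.single (a', b) 1 \<in> tensor_rels S"
| add_right: "Poly_Mapping.single (a, b + b') 1 - Poly_Mapping.single (a, b) 1
               - Poly_Mapping.single (a, b') 1 \<in> tensor_rels S"
| balanced: "s \<in> S \<Longrightarrow>
    Poly_Mapping.single (a * s, b) 1 - Poly_Mapping.single (a, s * b) 1 \<in> tensor_rels S"

definition tensor_eq ::
    "'a::{ring,monoid_mult} set \<Rightarrow> ('a \<times> 'a) list \<Rightarrow> ('a \<times> 'a) list \<Rightarrow> bool" where
  "tensor_eq S ps qs \<longleftrightarrow>
     (\<Sum>p\<leftarrow>ps. Poly_Mapping.single p 1) - (\<Sum>q\<leftarrow>qs. Poly_Mapping.single q 1) \<in> tensor_rels S"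

text \<open>
  Separability: the multiplication map from the tensor product to T has a section that is a
  homomorphism of T-bimodules. Concatenation of lists is addition of tensors.
\<close>

definition separable_over :: "'a::{ring,monoid_mult} set \<Rightarrow> bool" where
  "separable_over S \<longleftrightarrow>
     (\<exists>\<sigma> :: 'a \<Rightarrow> ('a \<times> 'a) list.
        (\<forall>x y. tensor_eq S (\<sigma> (x + y)) (\<sigma> x @ \<sigma> y)) \<and>
        (\<forall>a x b. tensor_eq S (\<sigma> (a * x * b)) (map (\<lambda>(p, q). (a * p, q * b)) (\<sigma> x))) \<and>
        (\<forall>x. (\<Sum>(p, q)\<leftarrow>\<sigma> x. p * q) = x))"

definition center :: "'a::{ring,monoid_mult} set" where
  "center = {z. \<forall>a. z * a = a * z}"

definition azumaya_over :: "'a::{ring,monoid_mult} set \<Rightarrow> bool" where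
  "azumaya_over S \<longleftrightarrow> center = S \<and> separable_over S"

section \<open>Maximal commutative subalgebras\<close>

definition commutative_set :: "'a::{ring,monoid_mult} set \<Rightarrow> bool" where
  "commutative_set B \<longleftrightarrow> (\<forall>a\<in>B. \<forall>b\<in>B. a * b = b * a)"

definition subalgebra_over :: "'a::{ring,monoid_mult} set \<Rightarrow> 'a set \<Rightarrow> bool" where
  "subalgebra_over S B \<longleftrightarrow>
     additive_subgroup B \<and> 1 \<in> B \<and> (\<forall>a\<in>B. \<forall>b\<in>B. a * b \<in> B) \<and> (\<forall>s\<in>S. \<forall>b\<in>B. s * b \<in> B)"

definition maximal_commutative_subalgebra :: "'a::{ring,monoid_mult} set \<Rightarrow> 'a set \<Rightarrow> bool" where
  "maximal_commutative_subalgebra S B \<longleftrightarrow>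
     subalgebra_over S B \<and> commutative_set B \<and>
     (\<forall>C. subalgebra_over S C \<and> commutative_set C \<and> B \<subseteq> C \<longrightarrow> C = B)"

end

(*
  Every a of degree g satisfies a r = gamma_g(r) a for r in R. Comparing sum_i x_i z y_i with z for z
  commuting with R shows that R is its own centralizer, which gives maximality and, with the
  elements u and v, identifies the centre with R^gamma.

  For separability let tr be the sum of the gamma_g, a map from R to R^gamma. The Galois coordinates
  yield a = sum_i x_i tr(y_i a) = sum_i tr(a x_i) y_i, so that f = sum_i x_i (x) y_i is a separability
  idempotent of R over R^gamma, and by Nakayama tr(c) = 1 for some c in R. Then
  e = sum_g sum_j u_{j,g} c f v_{j,-g} multiplies to tr(c) = 1 and commutes with A.
*)

theory Submission imports Defs begin

section \<open>Equality of tensors\<close>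

abbreviation pure_tensor :: "'a \<Rightarrow> 'a \<Rightarrow> ('a \<times> 'a) \<Rightarrow>\<^sub>0 int" where
  "pure_tensor a b \<equiv> Poly_Mapping.single (a, b) 1"

text \<open>Equality in the tensor product on formal sums rather than on lists as in
  \<open>tensor_eq\<close>, so that sums over finite index sets can be rewritten termwise and
  chained in calculations.\<close>

definition tensor_cong ::
    "'a::{ring,monoid_mult} set \<Rightarrow> (('a \<times> 'a) \<Rightarrow>\<^sub>0 int) \<Rightarrow> (('a \<times> 'a) \<Rightarrow>\<^sub>0 int) \<Rightarrow> bool" where
  "tensor_cong S p q \<longleftrightarrow> p - q \<in> tensor_rels S"

lemma tensor_rels_uminus: "p \<in> tensor_rels S \<Longrightarrow> - p \<in> tensor_rels S"
  using tensor_rels.diff[OF tensor_rels.zero] by fastforce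

lemma tensor_rels_add: "p \<in> tensor_rels S \<Longrightarrow> q \<in> tensor_rels S \<Longrightarrow> p + q \<in> tensor_rels S"
  using tensor_rels.diff[of p S "- q"] tensor_rels_uminus[of q S] by simp

lemma tensor_cong_refl [simp, intro]: "tensor_cong S p p"
  by (simp add: tensor_cong_def tensor_rels.zero)

lemma tensor_cong_sym: "tensor_cong S p q \<Longrightarrow> tensor_cong S q p"
  unfolding tensor_cong_def using tensor_rels_uminus[of "p - q" S] by simp

lemma tensor_cong_trans [trans]:
  "tensor_cong S p q \<Longrightarrow> tensor_cong S q r \<Longrightarrow> tensor_cong S p r"
  unfolding tensor_cong_def using tensor_rels_add[of "p - q" S "q - r"] by simp

lemma tensor_cong_add:
  assumes "tensor_cong S p q" "tensor_cong S p' q'"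
  shows "tensor_cong S (p + p') (q + q')"
  using assms tensor_rels_add[of "p - q" S "p' - q'"]
  unfolding tensor_cong_def by (simp add: algebra_simps)

lemma tensor_cong_sum:
  "(\<And>i. i \<in> I \<Longrightarrow> tensor_cong S (f i) (h i)) \<Longrightarrow> tensor_cong S (sum f I) (sum h I)"
  by (induction I rule: infinite_finite_induct) (auto intro: tensor_cong_add)

lemma pure_tensor_add_left:
  "tensor_cong S (pure_tensor (a + a') b) (pure_tensor a b + pure_tensor a' b)"
  using tensor_rels.add_left[of a a' b S] unfolding tensor_cong_def by (simp add: algebra_simps)

lemma pure_tensor_add_right:
  "tensor_cong S (pure_tensor a (b + b')) (pure_tensor a b + pure_tensor a b')"
  using tensor_rels.add_right[of a b b' S] unfolding tensor_cong_def by (simp add: algebra_simps)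

lemma pure_tensor_balanced:
  "s \<in> S \<Longrightarrow> tensor_cong S (pure_tensor (a * s) b) (pure_tensor a (s * b))"
  unfolding tensor_cong_def by (rule tensor_rels.balanced)

lemma pure_tensor_zero_left: "tensor_cong S (pure_tensor 0 b) 0"
  using tensor_rels_uminus[OF tensor_rels.add_left[of 0 0 b S]] unfolding tensor_cong_def by simp

lemma pure_tensor_zero_right: "tensor_cong S (pure_tensor a 0) 0"
  using tensor_rels_uminus[OF tensor_rels.add_right[of a 0 0 S]] unfolding tensor_cong_def by simp

lemma pure_tensor_sum_left:
  "tensor_cong S (pure_tensor (sum f I) b) (\<Sum>i\<in>I. pure_tensor (f i) b)"
proof (induction I rule: infinite_finite_induct)
  case (insert i I)
  then show ?case
    using tensor_cong_trans[OF pure_tensor_add_left tensor_cong_add[OF tensor_cong_refl]] by simp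
qed (simp_all add: pure_tensor_zero_left)

lemma pure_tensor_sum_right:
  "tensor_cong S (pure_tensor a (sum f I)) (\<Sum>i\<in>I. pure_tensor a (f i))"
proof (induction I rule: infinite_finite_induct)
  case (insert i I)
  then show ?case
    using tensor_cong_trans[OF pure_tensor_add_right tensor_cong_add[OF tensor_cong_refl]] by simp
qed (simp_all add: pure_tensor_zero_right)

text \<open>The sum of the tensors of \<open>p j\<close> and \<open>q j\<close> is a separability
  idempotent e, and the section is z |-> z e. Additivity and left linearity hold by construction;
  \<open>swap\<close> is right linearity. It carries a left factor \<open>a\<close> because e is
  used already multiplied by an element.\<close>

lemma separable_overI:
  fixes p q :: "'i \<Rightarrow> 'a::{ring,monoid_mult}"
  assumes fin: "finite J"
    and unit: "(\<Sum>j\<in>J. p j * q j) = 1"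
    and swap: "\<And>a b. tensor_cong S (\<Sum>j\<in>J. pure_tensor (a * b * p j) (q j))
                               (\<Sum>j\<in>J. pure_tensor (a * p j) (q j * b))"
  shows "separable_over S"
proof -
  obtain js where js: "set js = J" "distinct js"
    using finite_distinct_list[OF fin] by blast
  have list_sum: "(\<Sum>j\<leftarrow>js. f j) = sum f J" for f :: "'i \<Rightarrow> 'b::comm_monoid_add"
    using js by (simp add: sum_list_distinct_conv_sum_set)
  define \<sigma> where "\<sigma> z = map (\<lambda>j. (z * p j, q j)) js" for z
  have add: "tensor_eq S (\<sigma> (z + w)) (\<sigma> z @ \<sigma> w)" for z w
  proof -
    have "tensor_cong S (\<Sum>j\<in>J. pure_tensor ((z + w) * p j) (q j))
            (\<Sum>j\<in>J. pure_tensor (z * p j) (q j) + pure_tensor (w * p j) (q j))"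
      by (intro tensor_cong_sum) (simp add: distrib_right pure_tensor_add_left)
    then show ?thesis
      by (simp add: tensor_eq_def tensor_cong_def \<sigma>_def o_def list_sum sum.distrib)
  qed
  have bimod: "tensor_eq S (\<sigma> (a * z * b)) (map (\<lambda>(p, q). (a * p, q * b)) (\<sigma> z))" for a z b
    using swap[of "a * z" b]
    by (simp add: tensor_eq_def tensor_cong_def \<sigma>_def o_def list_sum mult.assoc)
  have mult: "(\<Sum>(p, q)\<leftarrow>\<sigma> z. p * q) = z" for z
  proof -
    have "(\<Sum>(p, q)\<leftarrow>\<sigma> z. p * q) = z * (\<Sum>j\<in>J. p j * q j)"
      by (simp add: \<sigma>_def o_def list_sum sum_distrib_left mult.assoc)
    then show ?thesis using unit by simp
  qed
  show ?thesis
    unfolding separable_over_def using add bimod mult by blast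
qed

section \<open>Nakayama's lemma\<close>

lemma additive_subgroup_add:
  assumes "additive_subgroup X" "a \<in> X" "b \<in> X"
  shows "a + b \<in> X"
proof -
  have "a - (0 - b) \<in> X"
    using assms unfolding additive_subgroup_def by blast
  then show ?thesis by simp
qed

lemma additive_subgroup_sum:
  assumes "additive_subgroup X" "\<And>i. i \<in> K \<Longrightarrow> f i \<in> X"
  shows "sum f K \<in> X"
  using assms(2)
  by (induction K rule: infinite_finite_induct)
     (use assms(1) in \<open>auto intro: additive_subgroup_add simp: additive_subgroup_def\<close>)

text \<open>Elimination of one generator at a time replaces the usual determinant.\<close>

lemma nakayama:
  fixes x :: "nat \<Rightarrow> 'a::{ring,monoid_mult}"
  assumes I: "additive_subgroup I" "\<And>a b. a \<in> I \<Longrightarrow> b \<in> I \<Longrightarrow> a * b \<in> I"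
    and comm: "\<And>a b. a \<in> I \<Longrightarrow> b \<in> I \<Longrightarrow> a * b = b * a"
    and "\<And>i j. i < k \<Longrightarrow> j < k \<Longrightarrow> a i j \<in> I"
    and "\<And>i. i < k \<Longrightarrow> x i = (\<Sum>j<k. a i j * x j)"
  shows "\<exists>t\<in>I. \<forall>i<k. t * x i = x i"
  using assms(4,5)
proof (induction k arbitrary: a)
  case 0
  then show ?case using I(1) by (auto simp: additive_subgroup_def)
next
  case (Suc k)
  define d where "d = a k k"
  have dI: "d \<in> I" unfolding d_def using Suc.prems(1) by simp
  have xk: "x k = d * x k + (\<Sum>j<k. a k j * x j)"
    using Suc.prems(2)[of k] by (simp add: d_def add.commute)
  have rk: "(\<Sum>j<k. a k j * x j) = x k - d * x k"
    using xk by (metis add_diff_cancel_left')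
  \<comment> \<open>Multiply the equation for \<open>x i\<close> by 1 - d, replace (1 - d)
    \<open>x k\<close> by the sum in \<open>rk\<close>, and bring d \<open>x i\<close> back to the
    right: this gives the coefficients \<open>b i j\<close>, and the diagonal term is d.\<close>
  define b where
    "b i j = a i j - d * a i j + a i k * a k j + (if i = j then d else 0)" for i j
  have sub: "a - b \<in> I" if "a \<in> I" "b \<in> I" for a b
    using I(1) that by (simp add: additive_subgroup_def)
  have zero: "0 \<in> I" using I(1) by (simp add: additive_subgroup_def)
  have bI: "b i j \<in> I" if "i < k" "j < k" for i j
    unfolding b_def
    using that dI zero Suc.prems(1)
    by (auto intro!: additive_subgroup_add[OF I(1)] sub I(2))
  have xb: "x i = (\<Sum>j<k. b i j * x j)" if i: "i < k" for i
  proof -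
    define s where "s = (\<Sum>j<k. a i j * x j)"
    have xi: "x i = s + a i k * x k"
      using Suc.prems(2)[of i] i by (simp add: s_def)
    have "(\<Sum>j<k. b i j * x j)
        = (\<Sum>j<k. a i j * x j - d * (a i j * x j) + a i k * (a k j * x j)
                 + (if i = j then d * x j else 0))"
      by (intro sum.cong) (auto simp: b_def algebra_simps)
    also have "\<dots> = s - d * s + a i k * (\<Sum>j<k. a k j * x j) + d * x i"
      using i by (simp add: s_def sum.distrib sum_subtractf sum_distrib_left)
    also have "\<dots> = s + a i k * x k - a i k * d * x k + d * a i k * x k"
      unfolding rk by (simp add: xi algebra_simps)
    also have "\<dots> = x i"
      using comm[OF dI Suc.prems(1)[of i k]] i xi by simp
    finally show ?thesis by simp
  qed
  obtain t where t: "t \<in> I" "\<forall>i<k. t * x i = x i"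
    using Suc.IH[of b] bI xb by blast
  have "t * (\<Sum>j<k. a k j * x j) = (\<Sum>j<k. a k j * x j)"
    unfolding sum_distrib_left
  proof (intro sum.cong refl)
    fix j assume j: "j \<in> {..<k}"
    have "t * (a k j * x j) = a k j * t * x j"
      using comm[OF t(1) Suc.prems(1)[of k j]] j by (simp flip: mult.assoc)
    also have "\<dots> = a k j * x j"
      using t(2) j by (simp add: mult.assoc)
    finally show "t * (a k j * x j) = a k j * x j" .
  qed
  then have "t * (x k - d * x k) = x k - d * x k"
    unfolding rk .
  \<comment> \<open>The new element is 1 - (1 - t)(1 - d), which lies in \<open>I\<close>. Here 1 -
    d maps \<open>x k\<close> to something fixed by t, and for i < k the two factors commute and 1 -
    t already kills \<open>x i\<close>.\<close>
  then have "(t + d - t * d) * x k = x k"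
    by (simp add: algebra_simps)
  moreover have "(t + d - t * d) * x i = x i" if "i < k" for i
    using t(2) that comm[OF t(1) dI] by (simp add: algebra_simps)
  moreover have "t + d - t * d \<in> I"
    using t(1) dI by (intro additive_subgroup_add[OF I(1)] sub I(2))
  ultimately show ?case
    by (auto simp: less_Suc_eq intro!: bexI[of _ "t + d - t * d"])
qed

section \<open>The partial action\<close>

declare One_nat_def [simp del]

locale epsilon_graded_comm =
  fixes A :: "'g::group_add \<Rightarrow> 'a::{ring,monoid_mult} set"
    and \<epsilon> :: "'g \<Rightarrow> 'a"
    and n :: "'g \<Rightarrow> nat"
    and u v :: "nat \<Rightarrow> 'g \<Rightarrow> 'a"
  assumes esg: "epsilon_strongly_graded A \<epsilon>"
    and dec: "epsilon_decomposition A \<epsilon> n u v"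
    and comm: "commutative_set (A 0)"
begin

abbreviation \<gamma> :: "'g \<Rightarrow> 'a \<Rightarrow> 'a" where
  "\<gamma> \<equiv> gam n u v"

abbreviation S :: "'a set" where
  "S \<equiv> invariants (A 0) \<epsilon> \<gamma>"

section \<open>Degrees, the idempotents and the decomposition elements\<close>

lemma graded: "graded_ring A"
  using esg by (simp add: epsilon_strongly_graded_def)

lemma subgroup: "additive_subgroup (A g)"
  using graded by (simp add: graded_ring_def)

lemma zero_mem [simp]: "0 \<in> A g"
  using subgroup[of g] by (simp add: additive_subgroup_def)

text \<open>The degree of the product is a separate variable, so that a goal in degree 0 or
  \<open>- g\<close> unifies and only an equation in the group remains.\<close>

lemma mult_mem:
  assumes "a \<in> A g" "b \<in> A h" "k = g + h"
  shows "a * b \<in> A k"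
proof -
  have "a * b \<in> set_mult (A g) (A h)"
    unfolding set_mult_def
    by (rule CollectI, rule exI[of _ "Suc 0"], rule exI[of _ "\<lambda>_. a"], rule exI[of _ "\<lambda>_. b"])
       (use assms in simp)
  then show ?thesis
    using graded assms(3) unfolding graded_ring_def by blast
qed

lemma mult_mem0: "a \<in> A 0 \<Longrightarrow> b \<in> A 0 \<Longrightarrow> a * b \<in> A 0"
  by (rule mult_mem) auto

lemma comm0: "a \<in> A 0 \<Longrightarrow> b \<in> A 0 \<Longrightarrow> a * b = b * a"
  using comm by (simp add: commutative_set_def)

lemma eps_left: "a \<in> A g \<Longrightarrow> \<epsilon> g * a = a"
  and eps_right: "a \<in> A g \<Longrightarrow> a * \<epsilon> (- g) = a"
  using esg by (auto simp: epsilon_strongly_graded_def)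

lemma eps_mem: "\<epsilon> g \<in> A 0"
proof -
  have "set_mult (A g) (A (- g)) \<subseteq> A (g + - g)"
    using graded unfolding graded_ring_def by blast
  moreover have "\<epsilon> g \<in> set_mult (A g) (A (- g))"
    using esg unfolding epsilon_strongly_graded_def by blast
  ultimately show ?thesis by auto
qed

lemma u_mem: "i \<in> {1..n g} \<Longrightarrow> u i g \<in> A g"
  and v_mem: "i \<in> {1..n g} \<Longrightarrow> v i (- g) \<in> A (- g)"
  and sum_uv: "(\<Sum>i=1..n g. u i g * v i (- g)) = \<epsilon> g"
  using dec by (auto simp: epsilon_decomposition_def)

lemma n0: "n 0 = 1" "u 1 0 = 1" "v 1 0 = 1"
  using dec by (auto simp: epsilon_decomposition_def)

lemma one_mem: "1 \<in> A 0"
  using u_mem[of 1 0] n0 by simp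

section \<open>The maps of the partial action and their composition\<close>

lemma gam_zero [simp]: "\<gamma> 0 r = r"
  using n0 by (simp add: gam_def)

lemma gam_add: "\<gamma> g (r + s) = \<gamma> g r + \<gamma> g s"
  by (simp add: gam_def algebra_simps sum.distrib)

lemma gam_0 [simp]: "\<gamma> g 0 = 0"
  by (simp add: gam_def)

lemma gam_sum: "\<gamma> g (sum f K) = (\<Sum>i\<in>K. \<gamma> g (f i))"
  by (induction K rule: infinite_finite_induct) (simp_all add: gam_add)

text \<open>Each \<open>v i (- g)\<close> has degree \<open>- g\<close> and absorbs the idempotent
  of \<open>- g\<close> from the left. So \<open>gam\<close> may be applied to every element of R,
  with the projection to the domain of \<gamma>_g built in; the later identities are stated in this
  form.\<close>

lemma gam_eps_absorb: "\<gamma> g (r * \<epsilon> (- g)) = \<gamma> g r"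
  unfolding gam_def by (intro sum.cong) (simp_all add: mult.assoc eps_left[OF v_mem])

lemma gam_mem: "r \<in> A 0 \<Longrightarrow> \<gamma> g r \<in> A 0"
  unfolding gam_def
  by (intro additive_subgroup_sum[OF subgroup] mult_mem[of _ g _ "- g"] mult_mem[of _ g r 0])
     (auto intro: u_mem v_mem)

lemma eps_gam: "\<epsilon> g * \<gamma> g r = \<gamma> g r"
  unfolding gam_def sum_distrib_left
  by (intro sum.cong) (simp_all flip: mult.assoc add: eps_left[OF u_mem])

text \<open>The product \<open>v i (- g) * a\<close> has degree 0, so r moves past it because R is
  commutative; what remains is the idempotent of g times \<open>a * r\<close>.\<close>

lemma gam_twist:
  assumes "a \<in> A g" "r \<in> A 0"
  shows "\<gamma> g r * a = a * r"
proof -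
  have "\<gamma> g r * a = (\<Sum>i=1..n g. u i g * v i (- g) * (a * r))"
    unfolding gam_def sum_distrib_right
  proof (intro sum.cong refl)
    fix i assume i: "i \<in> {1..n g}"
    have "v i (- g) * a \<in> A 0"
      by (rule mult_mem[OF v_mem[OF i] assms(1)]) simp
    then have "r * (v i (- g) * a) = v i (- g) * a * r"
      using comm0 assms(2) by blast
    then show "u i g * r * v i (- g) * a = u i g * v i (- g) * (a * r)"
      by (simp add: mult.assoc)
  qed
  also have "\<dots> = \<epsilon> g * a * r"
    unfolding sum_distrib_right[symmetric] sum_uv by (simp add: mult.assoc)
  finally show ?thesis
    using eps_left[OF assms(1)] by simp
qed

text \<open>In the sum for s, the factor \<open>\<gamma> g r\<close> passes each
  \<open>u i g\<close> by \<open>gam_twist\<close> and arrives next to s as r.\<close>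

lemma gam_mult:
  assumes "r \<in> A 0" "s \<in> A 0"
  shows "\<gamma> g (r * s) = \<gamma> g r * \<gamma> g s"
proof -
  have "\<gamma> g r * \<gamma> g s = (\<Sum>i=1..n g. \<gamma> g r * u i g * s * v i (- g))"
    by (simp add: gam_def[of _ _ _ _ s] sum_distrib_left mult.assoc)
  also have "\<dots> = \<gamma> g (r * s)"
    unfolding gam_def[of _ _ _ _ "r * s"]
    by (intro sum.cong) (simp_all add: gam_twist[OF u_mem assms(1)] mult.assoc)
  finally show ?thesis by simp
qed

text \<open>Twisting in degree \<open>- g\<close> turns \<gamma>_{-g}(r) \<open>v i (- g)\<close>
  into \<open>v i (- g) * r\<close>. Hence \<gamma>_g and \<gamma>_{-g}, restricted to their ideals,
  are mutually inverse.\<close>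

lemma gam_inverse:
  assumes "r \<in> A 0"
  shows "\<gamma> g (\<gamma> (- g) r) = \<epsilon> g * r"
proof -
  have "\<gamma> g (\<gamma> (- g) r) = (\<Sum>i=1..n g. u i g * v i (- g) * r)"
    unfolding gam_def[of _ _ _ g]
    by (intro sum.cong) (simp_all add: gam_twist[OF v_mem assms] mult.assoc)
  then show ?thesis
    by (simp flip: sum_distrib_right add: sum_uv)
qed

text \<open>Expand the inner idempotent: the products \<open>u i h * u j g\<close> have degree
  \<open>h + g\<close>, so the idempotent of that degree fixes them.\<close>

lemma eps_gam_eps: "\<epsilon> (h + g) * \<gamma> h (\<epsilon> g) = \<gamma> h (\<epsilon> g)"
proof -
  have "\<epsilon> (h + g) * (u i h * \<epsilon> g * v i (- h)) = u i h * \<epsilon> g * v i (- h)" if i: "i \<in> {1..n h}" for i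
  proof -
    have "\<epsilon> (h + g) * (u i h * \<epsilon> g) = u i h * \<epsilon> g"
    proof -
      have "\<epsilon> (h + g) * (u i h * u j g) = u i h * u j g" if "j \<in> {1..n g}" for j
        by (rule eps_left[OF mult_mem[OF u_mem[OF i] u_mem[OF that] refl]])
      then show ?thesis
        unfolding sum_uv[of g, symmetric] sum_distrib_left
        by (intro sum.cong) (simp_all flip: mult.assoc)
    qed
    then show ?thesis by (simp flip: mult.assoc)
  qed
  then show ?thesis
    by (simp add: gam_def sum_distrib_left)
qed

text \<open>Each side absorbs the other. One direction is \<open>eps_gam\<close> with
  \<open>eps_gam_eps\<close>; the other is \<open>eps_gam_eps\<close> for \<open>- h\<close> and
  \<open>h + g\<close>, carried back by \<gamma>_h through \<open>gam_inverse\<close>.\<close>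

lemma gam_eps: "\<gamma> h (\<epsilon> g) = \<epsilon> h * \<epsilon> (h + g)"
proof -
  have "\<epsilon> h * \<epsilon> (h + g) = \<gamma> h (\<gamma> (- h) (\<epsilon> (h + g)))"
    by (simp add: gam_inverse eps_mem)
  also have "\<gamma> (- h) (\<epsilon> (h + g)) = \<epsilon> g * \<gamma> (- h) (\<epsilon> (h + g))"
    using eps_gam_eps[of "- h" "h + g"] by (simp add: add.assoc[symmetric])
  also have "\<gamma> h \<dots> = \<gamma> h (\<epsilon> g) * (\<epsilon> h * \<epsilon> (h + g))"
    by (simp add: gam_mult gam_mem eps_mem gam_inverse)
  also have "\<dots> = \<epsilon> h * \<epsilon> (h + g) * \<gamma> h (\<epsilon> g)"
    by (intro comm0 gam_mem mult_mem0 eps_mem)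
  also have "\<dots> = \<epsilon> (h + g) * (\<epsilon> h * \<gamma> h (\<epsilon> g))"
    unfolding comm0[OF eps_mem[of h] eps_mem[of "h + g"]] by (rule mult.assoc)
  also have "\<dots> = \<gamma> h (\<epsilon> g)"
    by (simp add: eps_gam eps_gam_eps)
  finally show ?thesis by simp
qed

text \<open>The composition law of the partial action. The product \<open>u i h * u j g\<close> has
  degree \<open>h + g\<close>, so r leaves it on the left as \<gamma>_{h+g}(r). The remaining double
  sum is \<open>\<gamma> h (\<epsilon> g)\<close>, known from \<open>gam_eps\<close>, and its factor
  of degree index \<open>h + g\<close> is absorbed.\<close>

lemma gam_gam:
  assumes "r \<in> A 0"
  shows "\<gamma> h (\<gamma> g r) = \<gamma> (h + g) r * \<epsilon> h"
proof -
  have "\<gamma> h (\<gamma> g r) = (\<Sum>i=1..n h. \<Sum>j=1..n g. u i h * u j g * r * v j (- g) * v i (- h))"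
    by (simp add: gam_def sum_distrib_left sum_distrib_right mult.assoc)
  also have "\<dots> = (\<Sum>i=1..n h. \<Sum>j=1..n g. \<gamma> (h + g) r * (u i h * u j g) * v j (- g) * v i (- h))"
  proof (intro sum.cong refl)
    fix i j assume "i \<in> {1..n h}" "j \<in> {1..n g}"
    from gam_twist[OF mult_mem[OF u_mem[OF this(1)] u_mem[OF this(2)] refl] assms]
    show "u i h * u j g * r * v j (- g) * v i (- h)
        = \<gamma> (h + g) r * (u i h * u j g) * v j (- g) * v i (- h)" by simp
  qed
  also have "\<dots> = \<gamma> (h + g) r * \<gamma> h (\<epsilon> g)"
    by (simp add: gam_def[of _ _ _ h] sum_uv[of g, symmetric] sum_distrib_left sum_distrib_right mult.assoc)
  also have "\<dots> = \<epsilon> (h + g) * \<gamma> (h + g) r * \<epsilon> h"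
    unfolding gam_eps comm0[OF eps_mem[of h] eps_mem[of "h + g"]]
    by (simp add: comm0[OF gam_mem[OF assms, of "h + g"] eps_mem[of "h + g"]] flip: mult.assoc)
  finally show ?thesis by (simp add: eps_gam)
qed

section \<open>Invariants, homogeneous components and the centre\<close>

lemma inv_iff: "t \<in> S \<longleftrightarrow> t \<in> A 0 \<and> (\<forall>g. \<gamma> g t = t * \<epsilon> g)"
  by (simp add: invariants_def gam_eps_absorb)

lemma homogeneous_sum:
  obtains c K where "finite K" "\<And>g. c g \<in> A g" "a = (\<Sum>g\<in>K. c g)"
proof -
  obtain c where "\<forall>g. c g \<in> A g" "finite {g. c g \<noteq> 0}" "a = (\<Sum>g | c g \<noteq> 0. c g)"
    using graded unfolding graded_ring_def by blast
  then show thesis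
    by (intro that[of "{g. c g \<noteq> 0}" c]) auto
qed

text \<open>For a component a of degree g, \<open>gam_twist\<close> and invariance give a t =
  \<gamma>_g(t) a = t \<epsilon>_g a = t a.\<close>

lemma inv_central:
  assumes "t \<in> S"
  shows "t * a = a * t"
proof -
  obtain c K where c: "\<And>g. c g \<in> A g" "a = (\<Sum>g\<in>K. c g)"
    using homogeneous_sum[of a] by metis
  have "t * c g = c g * t" for g
  proof -
    have "c g * t = t * (\<epsilon> g * c g)"
      using assms gam_twist[OF c(1), of t g] by (simp add: inv_iff mult.assoc)
    then show ?thesis using eps_left[OF c(1)] by simp
  qed
  then show ?thesis
    unfolding c(2) by (simp add: sum_distrib_left sum_distrib_right)
qed

lemma center_subset_inv:
  assumes "z \<in> center" "z \<in> A 0"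
  shows "z \<in> S"
proof -
  have "\<gamma> g z = z * \<epsilon> g" for g
  proof -
    have "\<gamma> g z = (\<Sum>i=1..n g. z * (u i g * v i (- g)))"
      unfolding gam_def using assms(1) by (intro sum.cong) (simp_all add: center_def mult.assoc)
    then show ?thesis by (simp flip: sum_distrib_left add: sum_uv)
  qed
  then show ?thesis using assms(2) by (simp add: inv_iff)
qed

lemma subalgebra: "subalgebra_over S (A 0)"
  using subgroup one_mem by (auto simp: subalgebra_over_def inv_iff intro: mult_mem0)

end

section \<open>Galois coordinates, the centralizer of R and the centre\<close>

locale partial_galois_extension = epsilon_graded_comm A \<epsilon> n u v
  for A :: "'g::group_add \<Rightarrow> 'a::{ring,monoid_mult} set" and \<epsilon> n u v +
  fixes m :: nat and x y :: "nat \<Rightarrow> 'a"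
  assumes finite_support: "finite {g. A g \<noteq> {0}}"
    and x_mem: "i \<in> {1..m} \<Longrightarrow> x i \<in> A 0"
    and y_mem: "i \<in> {1..m} \<Longrightarrow> y i \<in> A 0"
    and galois_eps: "(\<Sum>i=1..m. x i * \<gamma> g (y i * \<epsilon> (- g))) = (if g = 0 then 1 else 0)"
begin

lemma galois: "(\<Sum>i=1..m. x i * \<gamma> g (y i)) = (if g = 0 then 1 else 0)"
  using galois_eps[of g] by (simp add: gam_eps_absorb)

lemma sum_xy: "(\<Sum>i=1..m. x i * y i) = 1"
  using galois[of 0] by simp

text \<open>Apply \<gamma>_g to the Galois equation at \<open>- g\<close>: by
  \<open>gam_inverse\<close>, \<gamma>_g(x_i \<gamma>_{-g}(y_i)) is \<gamma>_g(x_i) \<epsilon>_g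
  y_i, and the idempotent is absorbed.\<close>

lemma galois_dual: "(\<Sum>i=1..m. \<gamma> g (x i) * y i) = (if g = 0 then 1 else 0)"
proof -
  have "(\<Sum>i=1..m. \<gamma> g (x i) * y i) = (\<Sum>i=1..m. \<gamma> g (x i * \<gamma> (- g) (y i)))"
  proof (intro sum.cong refl)
    fix i assume i: "i \<in> {1..m}"
    note [simp] = x_mem[OF i] y_mem[OF i]
    have "\<gamma> g (x i * \<gamma> (- g) (y i)) = \<gamma> g (x i) * \<epsilon> g * y i"
      by (simp add: gam_mult gam_mem gam_inverse mult.assoc)
    also have "\<gamma> g (x i) * \<epsilon> g = \<gamma> g (x i)"
      using comm0[OF eps_mem gam_mem[OF x_mem[OF i]], of g g] eps_gam by simp
    finally show "\<gamma> g (x i) * y i = \<gamma> g (x i * \<gamma> (- g) (y i))" by simp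
  qed
  also have "\<dots> = \<gamma> g (if g = 0 then 1 else 0)"
    using galois[of "- g"] by (simp flip: gam_sum)
  finally show ?thesis by (cases "g = 0") auto
qed

text \<open>Since z commutes with the \<open>y i\<close>, it equals the sum of the x_i z y_i. There
  the component of degree g gets the Galois sum at g as its coefficient, so only degree 0
  survives.\<close>

lemma centralizer:
  assumes "\<And>r. r \<in> A 0 \<Longrightarrow> z * r = r * z"
  shows "z \<in> A 0"
proof -
  obtain c K where K: "finite K" and c: "\<And>g. c g \<in> A g" "z = (\<Sum>g\<in>K. c g)"
    using homogeneous_sum[of z] by metis
  have "z = (\<Sum>i=1..m. x i * y i) * z"
    by (simp add: sum_xy)
  also have "\<dots> = (\<Sum>i=1..m. x i * (z * y i))"
    unfolding sum_distrib_right by (intro sum.cong) (simp_all add: assms y_mem mult.assoc)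
  also have "\<dots> = (\<Sum>g\<in>K. \<Sum>i=1..m. x i * (c g * y i))"
    unfolding c(2) by (subst sum.swap) (simp add: sum_distrib_left sum_distrib_right)
  also have "\<dots> = (\<Sum>g\<in>K. (\<Sum>i=1..m. x i * \<gamma> g (y i)) * c g)"
    unfolding sum_distrib_right
    by (intro sum.cong) (simp_all add: gam_twist[OF c(1)] y_mem mult.assoc)
  also have "\<dots> = (\<Sum>g\<in>K. if g = 0 then c g else 0)"
    unfolding galois by (intro sum.cong) auto
  also have "\<dots> \<in> A 0"
    using c(1)[of 0] K by simp
  finally show ?thesis .
qed

lemma center_eq: "center = S"
proof
  show "center \<subseteq> S"
  proof
    fix z :: 'a assume "z \<in> center"
    moreover from this have "z \<in> A 0"
      by (intro centralizer) (simp add: center_def)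
    ultimately show "z \<in> S" by (rule center_subset_inv)
  qed
  show "S \<subseteq> center"
    using inv_central by (auto simp: center_def)
qed

lemma maximal_commutative: "maximal_commutative_subalgebra S (A 0)"
  unfolding maximal_commutative_subalgebra_def
proof (intro conjI allI impI subalgebra comm)
  fix C assume C: "subalgebra_over S C \<and> commutative_set C \<and> A 0 \<subseteq> C"
  then have "C \<subseteq> A 0"
    by (auto simp: commutative_set_def intro!: centralizer)
  with C show "C = A 0" by blast
qed

section \<open>The trace\<close>

text \<open>A sum over an infinite set is 0 in HOL, so the range is the support, which
  \<open>finite_support\<close> makes finite; the maps \<gamma>_g outside it vanish.\<close>

definition trace :: "'a \<Rightarrow> 'a" where
  "trace a = (\<Sum>g | A g \<noteq> {0}. \<gamma> g a)"

lemma u_outside_support: "A g = {0} \<Longrightarrow> i \<in> {1..n g} \<Longrightarrow> u i g = 0"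
  using u_mem by blast

lemma gam_outside_support: "A g = {0} \<Longrightarrow> \<gamma> g a = 0"
  unfolding gam_def by (intro sum.neutral) (simp add: u_outside_support)

lemma trace_superset:
  assumes "finite K" "{g. A g \<noteq> {0}} \<subseteq> K"
  shows "trace a = (\<Sum>g\<in>K. \<gamma> g a)"
  unfolding trace_def using assms gam_outside_support
  by (intro sum.mono_neutral_left) auto

lemma trace_add: "trace (a + b) = trace a + trace b"
  by (simp add: trace_def gam_add sum.distrib)

lemma trace_0 [simp]: "trace 0 = 0"
  by (simp add: trace_def)

lemma trace_mem: "a \<in> A 0 \<Longrightarrow> trace a \<in> A 0"
  unfolding trace_def by (intro additive_subgroup_sum[OF subgroup] gam_mem)

text \<open>The support F need not be stable under translation by h. The union of F and its
  translate by \<open>- h\<close> contains F, and so does its translate by h; a sum over F can thus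
  be widened, reindexed by g |-> \<open>h + g\<close> and narrowed again.\<close>

lemma support_shift:
  obtains K where "finite K" "{g. A g \<noteq> {0}} \<subseteq> K" "{g. A g \<noteq> {0}} \<subseteq> (+) h ` K"
proof
  let ?F = "{g. A g \<noteq> {0}}"
  show "finite (?F \<union> (+) (- h) ` ?F)"
    using finite_support by simp
  have "k \<in> (+) h ` (+) (- h) ` ?F" if "k \<in> ?F" for k
    by (rule image_eqI[of _ _ "- h + k"]) (use that in \<open>auto simp: add.assoc[symmetric]\<close>)
  then show "?F \<subseteq> (+) h ` (?F \<union> (+) (- h) ` ?F)"
    by blast
qed auto

text \<open>By \<open>gam_gam\<close>, \<gamma>_h turns the summand at g into the one at
  \<open>h + g\<close> times \<epsilon>_h, and translation only permutes the summands.\<close>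

lemma trace_inv:
  assumes "a \<in> A 0"
  shows "trace a \<in> S"
proof -
  have "\<gamma> h (trace a) = trace a * \<epsilon> h" for h
  proof -
    obtain K where K: "finite K" "{g. A g \<noteq> {0}} \<subseteq> K" "{g. A g \<noteq> {0}} \<subseteq> (+) h ` K"
      by (rule support_shift)
    have "\<gamma> h (trace a) = (\<Sum>g\<in>K. \<gamma> (h + g) a) * \<epsilon> h"
      by (simp add: trace_superset[OF K(1,2)] gam_sum gam_gam[OF assms] sum_distrib_right)
    also have "(\<Sum>g\<in>K. \<gamma> (h + g) a) = (\<Sum>g\<in>(+) h ` K. \<gamma> g a)"
      by (subst sum.reindex) auto
    also have "\<dots> = trace a"
      using K by (intro trace_superset[symmetric]) auto
    finally show ?thesis .
  qed
  then show ?thesis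
    using trace_mem[OF assms] by (simp add: inv_iff)
qed

text \<open>The premise covers the zero ring, where 0 is outside the support and the sum is
  empty.\<close>

lemma sum_support_delta: "(\<Sum>g | A g \<noteq> {0}. if g = 0 then f g else 0) = f 0"
  if "A 0 = {0} \<Longrightarrow> f 0 = 0" for f :: "'g \<Rightarrow> 'a"
  using that finite_support by (simp add: sum.delta)

text \<open>After exchanging the sums, the coefficient of \<gamma>_g(a) is the Galois sum at g, so
  the term g = 0 remains. The maps a |-> \<open>trace (y j * a)\<close> are thus coordinates with
  respect to the \<open>x j\<close>.\<close>

lemma trace_expansion_x:
  assumes "a \<in> A 0"
  shows "(\<Sum>j=1..m. x j * trace (y j * a)) = a"
proof -
  have "(\<Sum>j=1..m. x j * trace (y j * a))
      = (\<Sum>g | A g \<noteq> {0}. \<Sum>j=1..m. x j * (\<gamma> g (y j) * \<gamma> g a))"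
    unfolding trace_def
    by (subst sum.swap) (simp add: sum_distrib_left gam_mult y_mem assms)
  also have "\<dots> = (\<Sum>g | A g \<noteq> {0}. (\<Sum>j=1..m. x j * \<gamma> g (y j)) * \<gamma> g a)"
    by (simp add: sum_distrib_right mult.assoc)
  also have "\<dots> = (\<Sum>g | A g \<noteq> {0}. if g = 0 then \<gamma> g a else 0)"
    unfolding galois by (intro sum.cong) auto
  also have "\<dots> = a"
    using assms by (subst sum_support_delta) auto
  finally show ?thesis .
qed

lemma trace_expansion_y:
  assumes "a \<in> A 0"
  shows "(\<Sum>i=1..m. trace (a * x i) * y i) = a"
proof -
  have "(\<Sum>i=1..m. trace (a * x i) * y i)
      = (\<Sum>g | A g \<noteq> {0}. \<Sum>i=1..m. \<gamma> g a * \<gamma> g (x i) * y i)"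
    unfolding trace_def
    by (subst sum.swap) (simp add: sum_distrib_right gam_mult x_mem assms)
  also have "\<dots> = (\<Sum>g | A g \<noteq> {0}. \<gamma> g a * (\<Sum>i=1..m. \<gamma> g (x i) * y i))"
    by (simp add: sum_distrib_left mult.assoc)
  also have "\<dots> = (\<Sum>g | A g \<noteq> {0}. if g = 0 then \<gamma> g a else 0)"
    unfolding galois_dual by (intro sum.cong) auto
  also have "\<dots> = a"
    using assms by (subst sum_support_delta) auto
  finally show ?thesis .
qed

lemma trace_inv_mult:
  assumes "t \<in> S" "a \<in> A 0"
  shows "trace (t * a) = t * trace a"
proof -
  have "\<gamma> g (t * a) = t * \<gamma> g a" for g
    using assms by (simp add: gam_mult inv_iff mult.assoc eps_gam)
  then show ?thesis by (simp add: trace_def sum_distrib_left)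
qed

text \<open>
  The trace ideal I satisfies I R = R because of the expansion in terms of the x j, so I contains
  an element acting on R as 1.
\<close>

lemma trace_surj: "\<exists>c\<in>A 0. trace c = 1"
proof -
  let ?I = "trace ` A 0"
  have sub: "additive_subgroup ?I"
    unfolding additive_subgroup_def
  proof (intro conjI ballI)
    show "0 \<in> ?I" by (rule image_eqI[of _ _ 0]) auto
    fix a b assume "a \<in> ?I" "b \<in> ?I"
    then obtain r s where rs: "r \<in> A 0" "s \<in> A 0" "a = trace r" "b = trace s" by blast
    have "r - s \<in> A 0"
      using rs subgroup[of 0] by (simp add: additive_subgroup_def)
    moreover have "a - b = trace (r - s)"
      using trace_add[of "r - s" s] rs by (simp add: algebra_simps)
    ultimately show "a - b \<in> ?I" by blast
  qed
  have mult: "a * b \<in> ?I" if ab: "a \<in> ?I" "b \<in> ?I" for a b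
  proof -
    obtain s where s: "s \<in> A 0" "b = trace s" using ab by blast
    have "a \<in> S" using ab trace_inv by blast
    then have "a * b = trace (a * s)" "a * s \<in> A 0"
      using s trace_inv_mult by (auto simp: inv_iff intro: mult_mem0)
    then show ?thesis by blast
  qed
  have central: "a * b = b * a" if "a \<in> ?I" for a b
    using that inv_central trace_inv by blast
  \<comment> \<open>The matrix comes from \<open>trace_expansion_x\<close> applied to each
    \<open>x i\<close>. Indices in \<open>{1..m}\<close> become \<open>Suc i\<close> with i < m to
    fit \<open>nakayama\<close>.\<close>
  have "\<exists>t\<in>?I. \<forall>i<m. t * x (Suc i) = x (Suc i)"
  proof (rule nakayama[where a = "\<lambda>i j. trace (y (Suc j) * x (Suc i))"])
    fix i assume i: "i < m"
    have xi: "x (Suc i) \<in> A 0" using i by (intro x_mem) simp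
    have "x (Suc i) = (\<Sum>j=1..m. x j * trace (y j * x (Suc i)))"
      using trace_expansion_x[OF xi] by simp
    also have "\<dots> = (\<Sum>j=1..m. trace (y j * x (Suc i)) * x j)"
      by (intro sum.cong refl inv_central[symmetric] trace_inv mult_mem0 y_mem xi)
    also have "\<dots> = (\<Sum>j<m. trace (y (Suc j) * x (Suc i)) * x (Suc j))"
      by (simp add: sum.atLeast1_atMost_eq One_nat_def)
    finally show "x (Suc i) = (\<Sum>j<m. trace (y (Suc j) * x (Suc i)) * x (Suc j))" .
  qed (use sub mult central x_mem y_mem in \<open>auto intro!: imageI mult_mem0\<close>)
  then obtain t where t: "t \<in> ?I" "\<forall>i<m. t * x (Suc i) = x (Suc i)" by blast
  have "t * x i = x i" if "i \<in> {1..m}" for i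
    using t(2) that by (cases i) auto
  \<comment> \<open>An element fixing every \<open>x i\<close> fixes the sum of the
    \<open>x i * y i\<close>, which is 1.\<close>
  then have "t * (\<Sum>i=1..m. x i * y i) = (\<Sum>i=1..m. x i * y i)"
    by (simp add: sum_distrib_left mult.assoc[symmetric])
  then have "t = 1" by (simp add: sum_xy)
  with t(1) show ?thesis by auto
qed

section \<open>The separability idempotent\<close>

text \<open>With f the sum of the tensors of \<open>x i\<close> and \<open>y i\<close>, this is r f
  = f r inside outer factors p and q. Expand \<open>r * x i\<close> in the \<open>x j\<close>; the
  coefficients are traces, hence invariant, and cross the tensor sign; on the right they reassemble
  to \<open>y j * r\<close> by \<open>trace_expansion_y\<close>.\<close>

lemma galois_tensor_swap:
  assumes r: "r \<in> A 0"
  shows "tensor_cong S (\<Sum>i=1..m. pure_tensor (p * r * x i) (y i * q))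
                       (\<Sum>i=1..m. pure_tensor (p * x i) (y i * r * q))"
proof -
  let ?t = "\<lambda>i j. trace (y j * r * x i)"
  have mem: "y j * r * x i \<in> A 0" if "i \<in> {1..m}" "j \<in> {1..m}" for i j
    using that r by (intro mult_mem0 x_mem y_mem)
  have 1: "p * r * x i = (\<Sum>j=1..m. p * x j * ?t i j)" if "i \<in> {1..m}" for i
  proof -
    have "r * x i = (\<Sum>j=1..m. x j * ?t i j)"
      using trace_expansion_x[of "r * x i"] that r by (simp add: mult_mem0 x_mem mult.assoc)
    then have "p * r * x i = p * (\<Sum>j=1..m. x j * ?t i j)"
      by (metis mult.assoc)
    then show ?thesis by (simp add: sum_distrib_left mult.assoc)
  qed
  have 2: "(\<Sum>i=1..m. ?t i j * (y i * q)) = y j * r * q" if "j \<in> {1..m}" for j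
  proof -
    have "(\<Sum>i=1..m. ?t i j * y i) = y j * r"
      using that r by (intro trace_expansion_y mult_mem0 y_mem)
    then show ?thesis by (simp flip: mult.assoc sum_distrib_right)
  qed
  have "tensor_cong S (\<Sum>i=1..m. pure_tensor (p * r * x i) (y i * q))
          (\<Sum>i=1..m. \<Sum>j=1..m. pure_tensor (p * x j * ?t i j) (y i * q))"
    by (intro tensor_cong_sum) (simp only: 1 pure_tensor_sum_left)
  also have "tensor_cong S \<dots>
          (\<Sum>i=1..m. \<Sum>j=1..m. pure_tensor (p * x j) (?t i j * (y i * q)))"
    by (intro tensor_cong_sum pure_tensor_balanced trace_inv mem)
  also have "\<dots> = (\<Sum>j=1..m. \<Sum>i=1..m. pure_tensor (p * x j) (?t i j * (y i * q)))"
    by (rule sum.swap)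
  also have "tensor_cong S \<dots> (\<Sum>j=1..m. pure_tensor (p * x j) (\<Sum>i=1..m. ?t i j * (y i * q)))"
    by (intro tensor_cong_sum tensor_cong_sym[OF pure_tensor_sum_right])
  also have "\<dots> = (\<Sum>j=1..m. pure_tensor (p * x j) (y j * r * q))"
    by (intro sum.cong) (simp_all only: 2)
  finally show ?thesis .
qed

text \<open>
  For c of trace 1 the separability idempotent is the sum over g of the tensors
  sandwich c 1 g 1, which left multiplication by an element of degree h permutes as g goes to h + g.
\<close>

definition sandwich :: "'a \<Rightarrow> 'a \<Rightarrow> 'g \<Rightarrow> 'a \<Rightarrow> ('a \<times> 'a) \<Rightarrow>\<^sub>0 int" where
  "sandwich c z g w =
     (\<Sum>j=1..n g. \<Sum>i=1..m. pure_tensor (z * u j g * c * x i) (y i * v j (- g) * w))"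

lemma sandwich_outside_support:
  assumes "A g = {0}"
  shows "tensor_cong S (sandwich c z g w) 0"
proof -
  have "tensor_cong S (sandwich c z g w) (\<Sum>j=1..n g. \<Sum>i=1..m. 0)"
    unfolding sandwich_def
    by (intro tensor_cong_sum) (simp add: u_outside_support[OF assms] pure_tensor_zero_left)
  then show ?thesis by simp
qed

lemma sandwich_superset:
  assumes "finite K" "{g. A g \<noteq> {0}} \<subseteq> K"
  shows "tensor_cong S (\<Sum>g\<in>K. sandwich c z g w) (\<Sum>g | A g \<noteq> {0}. sandwich c z g w)"
proof -
  have "tensor_cong S (\<Sum>g\<in>K. sandwich c z g w)
          (\<Sum>g\<in>K. if A g \<noteq> {0} then sandwich c z g w else 0)"
    by (intro tensor_cong_sum) (auto intro: sandwich_outside_support)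
  also have "\<dots> = (\<Sum>g | A g \<noteq> {0}. sandwich c z g w)"
    using assms by (intro sum.mono_neutral_cong_right) auto
  finally show ?thesis .
qed

text \<open>Inserting the idempotent of \<open>h + g\<close> before \<open>a * u j g\<close> writes
  it as the sum over k of \<open>u k (h + g)\<close> times an element \<open>?r k j\<close> of R.
  That element commutes with c, crosses the middle tensor by \<open>galois_tensor_swap\<close>, and
  on the right the sum over j of \<open>?r k j * v j (- g)\<close> is
  \<open>v k (- ?k) * a\<close>.\<close>

lemma sandwich_shift:
  assumes c: "c \<in> A 0" and a: "a \<in> A h"
  shows "tensor_cong S (sandwich c (z * a) g w) (sandwich c z (h + g) (a * w))"
proof -
  let ?k = "h + g"
  let ?r = "\<lambda>k j. v k (- ?k) * a * u j g"
  have r_mem: "?r k j \<in> A 0" if "k \<in> {1..n ?k}" "j \<in> {1..n g}" for k j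
    using that a
    by (intro mult_mem[of _ "- g" _ g] mult_mem[of _ "- ?k" a h] u_mem v_mem)
       (auto simp: minus_add add.assoc)
  have left: "z * a * u j g * c * x i = (\<Sum>k=1..n ?k. z * u k ?k * c * ?r k j * x i)"
    if j: "j \<in> {1..n g}" for i j
  proof -
    have "a * u j g = \<epsilon> ?k * (a * u j g)"
      using mult_mem[OF a u_mem[OF j] refl] by (rule eps_left[symmetric])
    also have "\<dots> = (\<Sum>k=1..n ?k. u k ?k * ?r k j)"
      unfolding sum_uv[symmetric] by (simp add: sum_distrib_right mult.assoc)
    finally have "z * (a * u j g) * c * x i = (\<Sum>k=1..n ?k. z * (u k ?k * ?r k j) * c * x i)"
      by (simp add: sum_distrib_left sum_distrib_right)
    also have "\<dots> = (\<Sum>k=1..n ?k. z * u k ?k * (?r k j * c) * x i)"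
      by (simp add: mult.assoc)
    also have "\<dots> = (\<Sum>k=1..n ?k. z * u k ?k * (c * ?r k j) * x i)"
      by (intro sum.cong refl) (metis comm0[OF c] r_mem j)
    finally show ?thesis by (simp add: mult.assoc)
  qed
  have right: "(\<Sum>j=1..n g. y i * ?r k j * (v j (- g) * w)) = y i * v k (- ?k) * (a * w)"
    if k: "k \<in> {1..n ?k}" for i k
  proof -
    have va: "v k (- ?k) * a \<in> A (- g)"
      using k a by (intro mult_mem[of _ "- ?k" a h] v_mem) (auto simp: minus_add add.assoc)
    have "(\<Sum>j=1..n g. y i * ?r k j * (v j (- g) * w)) = y i * (v k (- ?k) * a * \<epsilon> g) * w"
      by (simp add: sum_uv[symmetric] sum_distrib_left sum_distrib_right mult.assoc)
    \<comment> \<open>The left factor has degree \<open>- g\<close>, so its right unit is the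
      idempotent of \<open>- (- g)\<close>, that is, of g.\<close>
    also have "v k (- ?k) * a * \<epsilon> g = v k (- ?k) * a"
      using eps_right[OF va] by simp
    finally show ?thesis by (simp add: mult.assoc)
  qed
  have "tensor_cong S (sandwich c (z * a) g w)
     (\<Sum>j=1..n g. \<Sum>i=1..m. \<Sum>k=1..n ?k.
        pure_tensor (z * u k ?k * c * ?r k j * x i) (y i * (v j (- g) * w)))"
    unfolding sandwich_def mult.assoc[of "y _"]
    by (intro tensor_cong_sum) (simp only: left pure_tensor_sum_left)
  also have "\<dots> = (\<Sum>j=1..n g. \<Sum>k=1..n ?k. \<Sum>i=1..m.
        pure_tensor (z * u k ?k * c * ?r k j * x i) (y i * (v j (- g) * w)))"
    by (intro sum.cong refl sum.swap)
  also have "tensor_cong S \<dots> (\<Sum>j=1..n g. \<Sum>k=1..n ?k. \<Sum>i=1..m.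
        pure_tensor (z * u k ?k * c * x i) (y i * ?r k j * (v j (- g) * w)))"
    by (intro tensor_cong_sum galois_tensor_swap r_mem)
  also have "\<dots> = (\<Sum>k=1..n ?k. \<Sum>i=1..m. \<Sum>j=1..n g.
        pure_tensor (z * u k ?k * c * x i) (y i * ?r k j * (v j (- g) * w)))"
    by (rule trans[OF sum.swap], rule sum.cong, rule refl, rule sum.swap)
  also have "tensor_cong S \<dots> (\<Sum>k=1..n ?k. \<Sum>i=1..m.
        pure_tensor (z * u k ?k * c * x i) (\<Sum>j=1..n g. y i * ?r k j * (v j (- g) * w)))"
    by (intro tensor_cong_sum tensor_cong_sym[OF pure_tensor_sum_right])
  also have "\<dots> = sandwich c z ?k (a * w)"
    unfolding sandwich_def by (intro sum.cong refl) (simp only: right)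
  finally show ?thesis .
qed

text \<open>As for the trace, \<open>sandwich_shift\<close> moves the summand at g to
  \<open>h + g\<close>, and the set K absorbs the translation of the support.\<close>

lemma sandwich_sum_swap_homogeneous:
  assumes c: "c \<in> A 0" and a: "a \<in> A h"
  shows "tensor_cong S (\<Sum>g | A g \<noteq> {0}. sandwich c (z * a) g w)
                       (\<Sum>g | A g \<noteq> {0}. sandwich c z g (a * w))"
proof -
  obtain K where K: "finite K" "{g. A g \<noteq> {0}} \<subseteq> K" "{g. A g \<noteq> {0}} \<subseteq> (+) h ` K"
    by (rule support_shift)
  have "tensor_cong S (\<Sum>g | A g \<noteq> {0}. sandwich c (z * a) g w) (\<Sum>g\<in>K. sandwich c (z * a) g w)"
    by (rule tensor_cong_sym[OF sandwich_superset[OF K(1,2)]])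
  also have "tensor_cong S \<dots> (\<Sum>g\<in>K. sandwich c z (h + g) (a * w))"
    by (intro tensor_cong_sum sandwich_shift c a)
  also have "\<dots> = (\<Sum>g\<in>(+) h ` K. sandwich c z g (a * w))"
    by (subst sum.reindex) auto
  also have "tensor_cong S \<dots> (\<Sum>g | A g \<noteq> {0}. sandwich c z g (a * w))"
    using K by (intro sandwich_superset) auto
  finally show ?thesis .
qed

lemma sandwich_sum_left:
  "tensor_cong S (sandwich c (z * sum f K) g w) (\<Sum>h\<in>K. sandwich c (z * f h) g w)"
proof -
  have "tensor_cong S (sandwich c (z * sum f K) g w)
          (\<Sum>j=1..n g. \<Sum>i=1..m. \<Sum>h\<in>K. pure_tensor (z * f h * u j g * c * x i) (y i * v j (- g) * w))"
    unfolding sandwich_def sum_distrib_left sum_distrib_right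
    by (intro tensor_cong_sum pure_tensor_sum_left)
  also have "\<dots> = (\<Sum>h\<in>K. sandwich c (z * f h) g w)"
    unfolding sandwich_def by (simp only: sum.swap[of _ K])
  finally show ?thesis .
qed

lemma sandwich_sum_right:
  "tensor_cong S (sandwich c z g (sum f K * w)) (\<Sum>h\<in>K. sandwich c z g (f h * w))"
proof -
  have "tensor_cong S (sandwich c z g (sum f K * w))
          (\<Sum>j=1..n g. \<Sum>i=1..m. \<Sum>h\<in>K. pure_tensor (z * u j g * c * x i) (y i * v j (- g) * (f h * w)))"
    unfolding sandwich_def sum_distrib_left sum_distrib_right
    by (intro tensor_cong_sum pure_tensor_sum_right)
  also have "\<dots> = (\<Sum>h\<in>K. sandwich c z g (f h * w))"
    unfolding sandwich_def by (simp only: sum.swap[of _ K])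
  finally show ?thesis .
qed

lemma sandwich_sum_swap:
  assumes c: "c \<in> A 0"
  shows "tensor_cong S (\<Sum>g | A g \<noteq> {0}. sandwich c (z * a) g w)
                       (\<Sum>g | A g \<noteq> {0}. sandwich c z g (a * w))"
proof -
  obtain f K where f: "\<And>h. f h \<in> A h" "a = (\<Sum>h\<in>K. f h)"
    using homogeneous_sum[of a] by metis
  have "tensor_cong S (\<Sum>g | A g \<noteq> {0}. sandwich c (z * a) g w)
          (\<Sum>g | A g \<noteq> {0}. \<Sum>h\<in>K. sandwich c (z * f h) g w)"
    unfolding f(2) by (intro tensor_cong_sum sandwich_sum_left)
  also have "\<dots> = (\<Sum>h\<in>K. \<Sum>g | A g \<noteq> {0}. sandwich c (z * f h) g w)"
    by (rule sum.swap)
  also have "tensor_cong S \<dots> (\<Sum>h\<in>K. \<Sum>g | A g \<noteq> {0}. sandwich c z g (f h * w))"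
    by (intro tensor_cong_sum sandwich_sum_swap_homogeneous[OF c f(1)])
  also have "\<dots> = (\<Sum>g | A g \<noteq> {0}. \<Sum>h\<in>K. sandwich c z g (f h * w))"
    by (rule sum.swap)
  also have "tensor_cong S \<dots> (\<Sum>g | A g \<noteq> {0}. sandwich c z g (a * w))"
    unfolding f(2) by (intro tensor_cong_sum tensor_cong_sym[OF sandwich_sum_right])
  finally show ?thesis .
qed

lemma separable: "separable_over S"
proof -
  obtain c where c: "c \<in> A 0" "trace c = 1"
    using trace_surj by blast
  let ?F = "{g. A g \<noteq> {0}}"
  \<comment> \<open>A dependent sum, since the range of j varies with g.\<close>
  let ?J = "SIGMA g:?F. {1..n g} \<times> {1..m}"
  let ?p = "\<lambda>(g, j, i). u j g * c * x i" and ?q = "\<lambda>(g, j, i). y i * v j (- g)"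
  have J: "(\<Sum>s\<in>?J. f s) = (\<Sum>g\<in>?F. \<Sum>j=1..n g. \<Sum>i=1..m. f (g, j, i))"
    for f :: "_ \<Rightarrow> 'b::comm_monoid_add"
    using finite_support by (simp add: sum.Sigma sum.cartesian_product)
  have tensor: "(\<Sum>s\<in>?J. pure_tensor (z * ?p s) (?q s * w)) = (\<Sum>g\<in>?F. sandwich c z g w)" for z w
    by (simp add: J sandwich_def mult.assoc)
  show ?thesis
  proof (rule separable_overI)
    show "finite ?J" using finite_support by simp
    \<comment> \<open>The inner sum of the \<open>x i * y i\<close> is 1, and what is left is the
      definition of \<gamma>_g(c) summed over the support.\<close>
    have "(\<Sum>s\<in>?J. ?p s * ?q s) = (\<Sum>g\<in>?F. \<Sum>j=1..n g. u j g * c * (\<Sum>i=1..m. x i * y i) * v j (- g))"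
      by (simp add: J sum_distrib_left sum_distrib_right mult.assoc)
    also have "\<dots> = trace c"
      by (simp add: sum_xy trace_def gam_def)
    finally show "(\<Sum>s\<in>?J. ?p s * ?q s) = 1" by (simp add: c)
    show "tensor_cong S (\<Sum>s\<in>?J. pure_tensor (a * b * ?p s) (?q s))
            (\<Sum>s\<in>?J. pure_tensor (a * ?p s) (?q s * b))" for a b
      \<comment> \<open>The outer factors are a on the left and 1 on the right; b is the element
        carried across.\<close>
      using sandwich_sum_swap[OF c(1), of a b 1] tensor[of "a * b" 1] tensor[of a b] by simp
  qed
qed

end

theorem theorem3p7:
  fixes A :: "'g::group_add \<Rightarrow> 'a::{ring,monoid_mult} set"
    and \<epsilon> :: "'g \<Rightarrow> 'a"
    and n :: "'g \<Rightarrow> nat"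
    and u v :: "nat \<Rightarrow> 'g \<Rightarrow> 'a"
  assumes "epsilon_strongly_graded A \<epsilon>"
    and "epsilon_decomposition A \<epsilon> n u v"
    and "commutative_set (A 0)"
    and "finite {g. A g \<noteq> {0}}"
    and "partial_galois (A 0) \<epsilon> (gam n u v)"
  shows "azumaya_over (invariants (A 0) \<epsilon> (gam n u v)) \<and>
         maximal_commutative_subalgebra (invariants (A 0) \<epsilon> (gam n u v)) (A 0)"
proof -
  obtain m x y where "\<forall>i\<in>{1..m::nat}. x i \<in> A 0 \<and> y i \<in> A 0"
    and "\<forall>g. (\<Sum>i=1..m. x i * gam n u v g (y i * \<epsilon> (- g))) = (if g = 0 then 1 else 0)"
    using assms(5) unfolding partial_galois_def by blast
  then interpret partial_galois_extension A \<epsilon> n u v m x y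
    using assms(1-4) by unfold_locales auto
  show ?thesis
    using center_eq separable maximal_commutative by (simp add: azumaya_over_def)
qed

end
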